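(* Consider an additive noise structural causal model on features $X_1,\dots,X_n$ and outcome $Y$ in which every feature is an ancestor of $Y$, with outcome equation $Y=g_Y(X_{\mathrm{pa}(Y)})+U_Y$, and individuals who best respond to the deployed mechanism. Then the mechanism $f=g_Y(X_{\mathrm{pa}(Y)})$ maximizes improvement and minimizes risk (among all mechanisms $f:\mathbb{R}^n\to\mathbb{R}$).
   Context: Model. Real-valued features $X_1,\dots,X_n$ and a real-valued outcome $Y$ follow a structural causal model over a directed acyclic graph with exogenous variables $U_1,\dots,U_n,U_Y$. Causal sufficiency holds: there are no unobserved common causes of the variables $X_1,\dots,X_n,Y$. The model is an additive noise model: $X_i=g_i(X_{\mathrm{pa}(i)})+U_i$ for $i\in\{1,\dots,n\}$ and $Y=g_Y(X_{\mathrm{pa}(Y)})+U_Y$, where $\mathrm{pa}(\cdot)$ denotes parents in the graph and the functions are $C^1$. The natural distribution $\mathcal{D}_0$ is the law of $(X,Y)$ absent manipulation. Best response. Facing a mechanism $f:\mathbb{R}^n\to\mathbb{R}$, an individual with realized exogenous values $u$ and features $x$ chooses $a^*\in\mathbb{R}^n$ maximizing $f(x')$ over $a\in\mathbb{R}^n$ subject to $x'_j=g_j(x'_{\mathrm{pa}(j)})+u_j+a_j$ for all $j\in\{1,\dots,n\}$ and $c(a_1,\dots,a_n;x)\le b$, where $c$ is the individual's cost function and $b$ the budget; $c$ is $C^1$, bounded, and satisfies $\nabla c\neq 0$ on the surface $c(a_1,\dots,a_n;x)=b$. The resulting features are $\tilde x_j=g_j(\tilde x_{\mathrm{pa}(j)})+u_j+a^*_j$,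 defined recursively. The outcome cannot be intervened on directly, so $\tilde y=g_Y(\tilde x_{\mathrm{pa}(Y)})+u_Y$. The law of $(\tilde X,\tilde Y)$ is the distribution $\mathcal{D}(f)$ induced by $f$. The improvement of $f$ is $\mathbb{E}_{\mathcal{D}(f)}[\tilde Y]-\mathbb{E}_{\mathcal{D}_0}[Y]$, and its risk is $\mathbb{E}_{\mathcal{D}(f)}[(f(\tilde X)-\tilde Y)^2]$.
   Formalization: The outcome noise U_Y is assumed integrable with mean zero; otherwise the risk claim fails (if E[U_Y]=m≠0, the mechanism g_Y+m has smaller risk). Best responses are measurable functions of the features' exogenous values. *)

theory Defs
  imports "HOL-Probability.Probability"
begin

datatype 'n node = Feature 'n | Outcome

definition parents :: "('n node \<times> 'n node) set \<Rightarrow> 'n node \<Rightarrow> 'n node set" where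
  "parents E v = {w. (w, v) \<in> E}"

definition ancestor :: "('n node \<times> 'n node) set \<Rightarrow> 'n node \<Rightarrow> 'n node \<Rightarrow> bool" where
  "ancestor E w v \<longleftrightarrow> (w, v) \<in> E\<^sup>+"

definition C1 :: "('a::real_inner \<Rightarrow> real) \<Rightarrow> bool" where
  "C1 h \<longleftrightarrow> (\<exists>G. continuous_on UNIV G \<and> (\<forall>x. GDERIV h x :> G x))"

text \<open>
  The structural function of a node is a function on the whole feature space that depends
  only on the coordinates of the node's parents. It has no argument for the outcome: when
  every feature is an ancestor of the outcome, acyclicity excludes edges out of the outcome.
  The absence of unobserved common causes is expressed by mutual independence of
  the exogenous variables.
\<close>

locale additive_noise_scm = prob_space M
  for M :: "'w measure" +
  fixes E :: "('n::finite node \<times> 'n node) set"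
    and g :: "'n node \<Rightarrow> real ^ 'n \<Rightarrow> real"
    and U :: "'n node \<Rightarrow> 'w \<Rightarrow> real"
  assumes dag: "acyclic E"
    and depends_on_parents:
      "\<And>v x x'. (\<And>j. Feature j \<in> parents E v \<Longrightarrow> x $ j = x' $ j) \<Longrightarrow> g v x = g v x'"
    and C1_structural: "\<And>v. C1 (g v)"
    and causally_sufficient: "indep_vars (\<lambda>_. borel) U UNIV"

definition feature_noise :: "('n::finite node \<Rightarrow> 'w \<Rightarrow> real) \<Rightarrow> 'w \<Rightarrow> real ^ 'n" where
  "feature_noise U \<omega> = (\<chi> j. U (Feature j) \<omega>)"

definition structural_solution ::
  "('n::finite node \<Rightarrow> real ^ 'n \<Rightarrow> real) \<Rightarrow> real ^ 'n \<Rightarrow> real ^ 'n \<Rightarrow> bool" where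
  "structural_solution g v x \<longleftrightarrow> (\<forall>j. x $ j = g (Feature j) x + v $ j)"

text \<open>
  The feature vector generated by the additive terms \<open>v\<close>; these are \<open>u\<close> without
  manipulation and \<open>u + a\<close> under the action \<open>a\<close>. Existence and uniqueness
  of the solution are shown in \<open>additive_noise_scm.structural_solution_ex1\<close> below.
\<close>

definition features ::
  "('n::finite node \<Rightarrow> real ^ 'n \<Rightarrow> real) \<Rightarrow> real ^ 'n \<Rightarrow> real ^ 'n" where
  "features g v = (THE x. structural_solution g v x)"

definition regular_cost :: "(real ^ 'n \<Rightarrow> real ^ 'n \<Rightarrow> real) \<Rightarrow> real \<Rightarrow> bool" where
  "regular_cost c b \<longleftrightarrow>
     (\<forall>x. C1 (\<lambda>a. c a x) \<and> bounded (range (\<lambda>a. c a x)) \<and>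
          (\<forall>a. c a x = b \<longrightarrow> \<not> (GDERIV (\<lambda>a'. c a' x) a :> 0)))"

definition feasible ::
  "('n::finite node \<Rightarrow> real ^ 'n \<Rightarrow> real) \<Rightarrow> (real ^ 'n \<Rightarrow> real ^ 'n \<Rightarrow> real) \<Rightarrow> real \<Rightarrow>
   real ^ 'n \<Rightarrow> (real ^ 'n) set" where
  "feasible g c b u = {a. c a (features g u) \<le> b}"

definition best_responses ::
  "('n::finite node \<Rightarrow> real ^ 'n \<Rightarrow> real) \<Rightarrow> (real ^ 'n \<Rightarrow> real ^ 'n \<Rightarrow> real) \<Rightarrow> real \<Rightarrow>
   (real ^ 'n \<Rightarrow> real) \<Rightarrow> real ^ 'n \<Rightarrow> (real ^ 'n) set" where
  "best_responses g c b f u =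
     {a \<in> feasible g c b u.
        \<forall>a' \<in> feasible g c b u. f (features g (u + a')) \<le> f (features g (u + a))}"

text \<open>
  A best-response rule selects one maximizer for (almost) every individual. The decision
  problem involves only the exogenous values \<open>u\<close> of the features (which determine the
  features themselves), so the rule, in particular its tie-breaking, is a function of these.
\<close>

definition best_response_rule ::
  "'w measure \<Rightarrow> ('n::finite node \<Rightarrow> real ^ 'n \<Rightarrow> real) \<Rightarrow> ('n node \<Rightarrow> 'w \<Rightarrow> real) \<Rightarrow>
   (real ^ 'n \<Rightarrow> real ^ 'n \<Rightarrow> real) \<Rightarrow> real \<Rightarrow>
   (real ^ 'n \<Rightarrow> real) \<Rightarrow> (real ^ 'n \<Rightarrow> real ^ 'n) \<Rightarrow> bool" where
  "best_response_rule M g U c b f \<alpha> \<longleftrightarrow>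
     \<alpha> \<in> borel_measurable borel \<and>
     (AE \<omega> in M. \<alpha> (feature_noise U \<omega>) \<in> best_responses g c b f (feature_noise U \<omega>))"

definition joint_law ::
  "'w measure \<Rightarrow> ('n::finite node \<Rightarrow> real ^ 'n \<Rightarrow> real) \<Rightarrow> ('n node \<Rightarrow> 'w \<Rightarrow> real) \<Rightarrow>
   ('w \<Rightarrow> real ^ 'n) \<Rightarrow> ((real ^ 'n) \<times> real) measure" where
  "joint_law M g U V =
     distr M borel (\<lambda>\<omega>. (features g (V \<omega>), g Outcome (features g (V \<omega>)) + U Outcome \<omega>))"

definition natural_dist ::
  "'w measure \<Rightarrow> ('n::finite node \<Rightarrow> real ^ 'n \<Rightarrow> real) \<Rightarrow> ('n node \<Rightarrow> 'w \<Rightarrow> real) \<Rightarrow>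
   ((real ^ 'n) \<times> real) measure" where
  "natural_dist M g U = joint_law M g U (feature_noise U)"

definition induced_dist ::
  "'w measure \<Rightarrow> ('n::finite node \<Rightarrow> real ^ 'n \<Rightarrow> real) \<Rightarrow> ('n node \<Rightarrow> 'w \<Rightarrow> real) \<Rightarrow>
   (real ^ 'n \<Rightarrow> real ^ 'n) \<Rightarrow> ((real ^ 'n) \<times> real) measure" where
  "induced_dist M g U \<alpha> =
     joint_law M g U (\<lambda>\<omega>. feature_noise U \<omega> + \<alpha> (feature_noise U \<omega>))"

definition improvement ::
  "'w measure \<Rightarrow> ('n::finite node \<Rightarrow> real ^ 'n \<Rightarrow> real) \<Rightarrow> ('n node \<Rightarrow> 'w \<Rightarrow> real) \<Rightarrow>
   (real ^ 'n \<Rightarrow> real ^ 'n) \<Rightarrow> real" where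
  "improvement M g U \<alpha> =
     (\<integral>p. snd p \<partial>induced_dist M g U \<alpha>) - (\<integral>p. snd p \<partial>natural_dist M g U)"

text \<open>The risk takes extended values, so that no second moments have to be assumed.\<close>

definition risk ::
  "'w measure \<Rightarrow> ('n::finite node \<Rightarrow> real ^ 'n \<Rightarrow> real) \<Rightarrow> ('n node \<Rightarrow> 'w \<Rightarrow> real) \<Rightarrow>
   (real ^ 'n \<Rightarrow> real) \<Rightarrow> (real ^ 'n \<Rightarrow> real ^ 'n) \<Rightarrow> ennreal" where
  "risk M g U f \<alpha> = (\<integral>\<^sup>+p. ennreal ((f (fst p) - snd p)\<^sup>2) \<partial>induced_dist M g U \<alpha>)"

lemma (in additive_noise_scm) structural_solution_ex1: "\<exists>!x. structural_solution g v x"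
proof -
  have inj: "inj (Feature :: 'n \<Rightarrow> 'n node)" by (simp add: inj_def)
  have UN: "(UNIV :: 'n node set) = insert Outcome (range Feature)"
    by (auto, metis node.exhaust rangeI)
  have "finite (UNIV :: 'n node set)" unfolding UN by simp
  then have "finite E" by (meson finite_Prod_UNIV finite_subset subset_UNIV)
  then have wfE: "wf E" using dag finite_acyclic_wf by blast
  define R :: "('n \<times> 'n) set" where "R = {(j, i). (Feature j, Feature i) \<in> E}"
  have R_eq: "R = inv_image E Feature" by (auto simp: R_def inv_image_def)
  have wfR: "wf R" unfolding R_eq using wfE by (rule wf_inv_image)
  have loc: "g (Feature i) x = g (Feature i) y" if "\<And>j. (j, i) \<in> R \<Longrightarrow> x $ j = y $ j" for i x y
    using that by (intro depends_on_parents) (auto simp: parents_def R_def)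
  define F where "F = (\<lambda>h i. g (Feature i) (\<chi> j. h j) + v $ i)"
  define X where "X = wfrec R F"
  have X: "X i = g (Feature i) (\<chi> j. X j) + v $ i" for i
  proof -
    have "X i = F (cut X R i) i" unfolding X_def by (rule wfrec[OF wfR])
    also have "\<dots> = g (Feature i) (\<chi> j. X j) + v $ i"
      unfolding F_def by (simp, rule loc) (simp add: cut_apply)
    finally show ?thesis .
  qed
  show ?thesis
  proof (rule ex1I[of _ "\<chi> j. X j"])
    show "structural_solution g v (\<chi> j. X j)" by (simp add: structural_solution_def X[symmetric])
  next
    fix y assume y: "structural_solution g v y"
    have "y $ i = X i" for i
    proof (induction i rule: wf_induct_rule[OF wfR])
      case (1 i)
      have "g (Feature i) y = g (Feature i) (\<chi> j. X j)" by (rule loc) (simp add: 1)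
      with y show ?case by (simp add: structural_solution_def X[of i])
    qed
    then show "y = (\<chi> j. X j)" by (simp add: vec_eq_iff)
  qed
qed

end

theory Submission imports Defs begin

text \<open>
  A response to any mechanism is feasible for the mechanism \<open>g Outcome\<close> too, so responses
  to \<open>g Outcome\<close> maximize \<open>g Outcome\<close> of the features pointwise, and the noise
  \<open>U Outcome\<close> is unaffected by actions. For the risk, the discrepancy between \<open>f\<close>
  and \<open>g Outcome\<close> at the induced features is a function of the feature noise alone, hence
  independent of the centered noise \<open>U Outcome\<close>; it can only add to the second moment of
  that noise, which is exactly the risk of \<open>g Outcome\<close>.
\<close>

lemma C1_imp_continuous_on: "C1 h \<Longrightarrow> continuous_on UNIV h"
  unfolding C1_def
  by (meson continuous_at_imp_continuous_on gderiv_def has_derivative_continuous)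

lemma borel_measurable_vec_lambda:
  fixes h :: "'n::finite \<Rightarrow> 'a \<Rightarrow> real"
  assumes "\<And>j. h j \<in> borel_measurable N"
  shows "(\<lambda>x. \<chi> j. h j x) \<in> borel_measurable N"
  unfolding borel_measurable_euclidean_space[of "\<lambda>x. \<chi> j. h j x"]
  using assms by (auto simp: Basis_vec_def inner_axis)

text \<open>Expanding the square, the cross term has mean zero, so shifting by \<open>k\<close> adds
  exactly \<open>k\<^sup>2\<close> to the second moment. An infinite right side makes the bound
  trivial.\<close>

lemma (in prob_space) second_moment_centered_le:
  fixes Y :: "'a \<Rightarrow> real"
  assumes Y: "integrable M Y" and E0: "(\<integral>\<omega>. Y \<omega> \<partial>M) = 0"
  shows "(\<integral>\<^sup>+\<omega>. ennreal ((Y \<omega>)\<^sup>2) \<partial>M) \<le> (\<integral>\<^sup>+\<omega>. ennreal ((k - Y \<omega>)\<^sup>2) \<partial>M)"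
proof (cases "(\<integral>\<^sup>+\<omega>. ennreal ((k - Y \<omega>)\<^sup>2) \<partial>M) = \<infinity>")
  case False
  have [measurable]: "Y \<in> borel_measurable M" using Y by simp
  have int: "integrable M (\<lambda>\<omega>. (k - Y \<omega>)\<^sup>2)"
    using False by (intro integrableI_nonneg) (auto simp: top.not_eq_extremum)
  \<comment> \<open>Solved for the square of \<open>Y\<close>, the expansion also yields its
    integrability, since every term on the right is integrable.\<close>
  have eq: "(Y \<omega>)\<^sup>2 = (k - Y \<omega>)\<^sup>2 + (2 * k * Y \<omega> - k\<^sup>2)" for \<omega>
    by (simp add: power2_eq_square algebra_simps)
  have int': "integrable M (\<lambda>\<omega>. (Y \<omega>)\<^sup>2)"
    unfolding eq using int Y by (intro Bochner_Integration.integrable_add) auto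
  have "(\<integral>\<omega>. (Y \<omega>)\<^sup>2 \<partial>M) = (\<integral>\<omega>. (k - Y \<omega>)\<^sup>2 \<partial>M) - k\<^sup>2"
    unfolding eq using int Y E0 by (simp add: prob_space)
  then show ?thesis
    using int int' by (simp add: nn_integral_eq_integral ennreal_leI)
qed simp

text \<open>By independence and Tonelli, the right side averages over the law of \<open>X\<close>
  the second moment of \<open>Y\<close> about a fixed point \<open>x\<close>; the centered bound
  applies for each \<open>x\<close> separately.\<close>

lemma (in prob_space) second_moment_indep_le:
  fixes X Y :: "'a \<Rightarrow> real"
  assumes ind: "indep_var borel X borel Y"
    and Y: "integrable M Y" "(\<integral>\<omega>. Y \<omega> \<partial>M) = 0"
  shows "(\<integral>\<^sup>+\<omega>. ennreal ((Y \<omega>)\<^sup>2) \<partial>M) \<le> (\<integral>\<^sup>+\<omega>. ennreal ((X \<omega> - Y \<omega>)\<^sup>2) \<partial>M)"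
proof -
  have X[measurable]: "X \<in> borel_measurable M" and Ym[measurable]: "Y \<in> borel_measurable M"
    and prod: "distr M borel X \<Otimes>\<^sub>M distr M borel Y = distr M (borel \<Otimes>\<^sub>M borel) (\<lambda>\<omega>. (X \<omega>, Y \<omega>))"
    using ind by (auto simp: indep_var_distribution_eq)
  interpret DX: prob_space "distr M borel X" by (rule prob_space_distr) simp
  interpret DY: prob_space "distr M borel Y" by (rule prob_space_distr) simp
  \<comment> \<open>A constant integrated against a probability measure: this puts both sides under
    the same outer integral.\<close>
  have "(\<integral>\<^sup>+\<omega>. ennreal ((Y \<omega>)\<^sup>2) \<partial>M) = (\<integral>\<^sup>+x. (\<integral>\<^sup>+\<omega>. ennreal ((Y \<omega>)\<^sup>2) \<partial>M) \<partial>distr M borel X)"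
    using DX.emeasure_space_1 by simp
  also have "\<dots> \<le> (\<integral>\<^sup>+x. (\<integral>\<^sup>+\<omega>. ennreal ((x - Y \<omega>)\<^sup>2) \<partial>M) \<partial>distr M borel X)"
    by (intro nn_integral_mono second_moment_centered_le Y)
  also have "\<dots> = (\<integral>\<^sup>+x. (\<integral>\<^sup>+y. ennreal ((x - y)\<^sup>2) \<partial>distr M borel Y) \<partial>distr M borel X)"
    by (simp add: nn_integral_distr)
  also have "\<dots> = (\<integral>\<^sup>+p. ennreal ((fst p - snd p)\<^sup>2) \<partial>(distr M borel X \<Otimes>\<^sub>M distr M borel Y))"
    by (subst DY.nn_integral_fst[symmetric]) auto
  also have "\<dots> = (\<integral>\<^sup>+\<omega>. ennreal ((X \<omega> - Y \<omega>)\<^sup>2) \<partial>M)"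
    unfolding prod by (subst nn_integral_distr) auto
  finally show ?thesis .
qed

context additive_noise_scm
begin

lemma features_nth: "features g v $ i = g (Feature i) (features g v) + v $ i"
proof -
  have "structural_solution g v (features g v)"
    unfolding features_def by (rule theI'[OF structural_solution_ex1])
  then show ?thesis by (simp add: structural_solution_def)
qed

lemma continuous_on_g: "continuous_on UNIV (g v)"
  using C1_structural by (rule C1_imp_continuous_on)

lemma wf_feature_edges: "wf {(j, i). (Feature j, Feature i) \<in> E}"
proof -
  have UN: "(UNIV :: 'n node set) = insert Outcome (range Feature)"
    by (auto, metis node.exhaust rangeI)
  have "finite (UNIV :: 'n node set)" unfolding UN by simp
  then have "finite E" by (meson finite_Prod_UNIV finite_subset subset_UNIV)
  then have "wf E" using dag finite_acyclic_wf by blast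
  then have "wf (inv_image E Feature)" by (rule wf_inv_image)
  then show ?thesis by (simp add: inv_image_def)
qed

text \<open>Continuity passes from parents to children along the finite acyclic graph. It is the
  source of measurability for \<open>features\<close>, which is given only by a definite
  description.\<close>

lemma continuous_on_features: "continuous_on UNIV (features g)"
proof -
  have "continuous_on UNIV (\<lambda>v. features g v $ i)" for i
  proof (induction i rule: wf_induct_rule[OF wf_feature_edges])
    case (1 i)
    \<comment> \<open>The induction hypothesis covers parent coordinates only. The others are set to
      0, which \<open>g (Feature i)\<close> cannot detect.\<close>
    let ?P = "\<lambda>v. \<chi> j. if (Feature j, Feature i) \<in> E then features g v $ j else 0"
    have "continuous_on UNIV (\<lambda>v. if (Feature j, Feature i) \<in> E then features g v $ j else 0)" for j
      using 1[of j] by (cases "(Feature j, Feature i) \<in> E") simp_all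
    then have "continuous_on UNIV ?P"
      by (rule continuous_on_vec_lambda)
    then have "continuous_on UNIV (\<lambda>v. g (Feature i) (?P v) + v $ i)"
      by (intro continuous_on_add continuous_on_compose2[OF continuous_on_g] continuous_on_component
          continuous_on_id) auto
    moreover have "g (Feature i) (?P v) = g (Feature i) (features g v)" for v
      by (rule depends_on_parents) (simp add: parents_def)
    ultimately show ?case
      by (subst features_nth) simp
  qed
  then have "continuous_on UNIV (\<lambda>v. \<chi> i. features g v $ i)"
    by (intro continuous_on_vec_lambda) auto
  then show ?thesis by simp
qed

lemma measurable_features [measurable]: "features g \<in> borel_measurable borel"
  by (rule borel_measurable_continuous_onI[OF continuous_on_features])

lemma measurable_g [measurable]: "g v \<in> borel_measurable borel"
  by (rule borel_measurable_continuous_onI[OF continuous_on_g])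

lemma measurable_U [measurable]: "U v \<in> borel_measurable M"
  using causally_sufficient by (auto simp: indep_vars_def)

lemma measurable_feature_noise [measurable]: "feature_noise U \<in> borel_measurable M"
  unfolding feature_noise_def[abs_def] by (intro borel_measurable_vec_lambda) simp

lemma measurable_joint:
  assumes [measurable]: "V \<in> borel_measurable M"
  shows "(\<lambda>\<omega>. (features g (V \<omega>), g Outcome (features g (V \<omega>)) + U Outcome \<omega>))
    \<in> borel_measurable M"
  by (intro borel_measurable_Pair) measurable

lemma integral_snd_joint_law:
  assumes "V \<in> borel_measurable M"
  shows "(\<integral>p. snd p \<partial>joint_law M g U V) = (\<integral>\<omega>. g Outcome (features g (V \<omega>)) + U Outcome \<omega> \<partial>M)"
  unfolding joint_law_def
  by (subst integral_distr[OF measurable_joint[OF assms]])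
    (simp_all add: borel_measurable_continuous_onI[OF continuous_on_snd[OF continuous_on_id]])

lemma integrable_snd_joint_law:
  assumes "V \<in> borel_measurable M"
  shows "integrable (joint_law M g U V) snd \<longleftrightarrow>
    integrable M (\<lambda>\<omega>. g Outcome (features g (V \<omega>)) + U Outcome \<omega>)"
  unfolding joint_law_def
  by (subst integrable_distr_eq[OF measurable_joint[OF assms]])
    (simp_all add: borel_measurable_continuous_onI[OF continuous_on_snd[OF continuous_on_id]])

lemma measurable_noise_plus_response:
  assumes "best_response_rule M g U c b f \<alpha>"
  shows "(\<lambda>\<omega>. feature_noise U \<omega> + \<alpha> (feature_noise U \<omega>)) \<in> borel_measurable M"
proof -
  have [measurable]: "\<alpha> \<in> borel_measurable borel"
    using assms by (simp add: best_response_rule_def)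
  show ?thesis by measurable
qed

lemma improvement_le:
  assumes Y: "best_response_rule M g U c b (g Outcome) \<alpha>\<^sub>Y"
    and f: "best_response_rule M g U c b f \<alpha>"
    and iY: "integrable (induced_dist M g U \<alpha>\<^sub>Y) snd"
    and i: "integrable (induced_dist M g U \<alpha>) snd"
  shows "improvement M g U \<alpha> \<le> improvement M g U \<alpha>\<^sub>Y"
proof -
  note mY = measurable_noise_plus_response[OF Y] and m = measurable_noise_plus_response[OF f]
  have "AE \<omega> in M. \<alpha>\<^sub>Y (feature_noise U \<omega>) \<in> best_responses g c b (g Outcome) (feature_noise U \<omega>)"
    "AE \<omega> in M. \<alpha> (feature_noise U \<omega>) \<in> best_responses g c b f (feature_noise U \<omega>)"
    using Y f by (auto simp: best_response_rule_def)
  \<comment> \<open>The feasible set does not involve the mechanism, so the response to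
    \<open>f\<close> is a competitor in the problem that \<open>\<alpha>\<^sub>Y\<close>
    solves.\<close>
  then have "AE \<omega> in M.
      g Outcome (features g (feature_noise U \<omega> + \<alpha> (feature_noise U \<omega>))) + U Outcome \<omega>
    \<le> g Outcome (features g (feature_noise U \<omega> + \<alpha>\<^sub>Y (feature_noise U \<omega>))) + U Outcome \<omega>"
    by eventually_elim (simp add: best_responses_def)
  \<comment> \<open>Integrability matters on both sides: the Bochner integral of a non-integrable
    function is 0 by default, which would break monotonicity. The natural mean cancels.\<close>
  with iY i show ?thesis
    unfolding improvement_def induced_dist_def integral_snd_joint_law[OF mY]
      integral_snd_joint_law[OF m] integrable_snd_joint_law[OF mY] integrable_snd_joint_law[OF m]
    by (simp add: integral_mono_AE)
qed

text \<open>Mutual independence passes to disjoint blocks of nodes, here all features against the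
  outcome, and then to measurable functions of the blocks.\<close>

lemma indep_var_feature_noise_outcome:
  assumes h: "h \<in> borel_measurable borel"
  shows "indep_var borel (\<lambda>\<omega>. h (feature_noise U \<omega>)) borel (U Outcome)"
proof -
  let ?A = "range Feature :: 'n node set" and ?B = "{Outcome} :: 'n node set"
  have "indep_var (PiM ?A (\<lambda>_. borel)) (\<lambda>\<omega>. restrict (\<lambda>i. U i \<omega>) ?A)
      (PiM ?B (\<lambda>_. borel)) (\<lambda>\<omega>. restrict (\<lambda>i. U i \<omega>) ?B)"
    by (rule indep_var_restrict[OF causally_sufficient]) auto
  then have "indep_var borel ((\<lambda>p. h (\<chi> j. p (Feature j))) \<circ> (\<lambda>\<omega>. restrict (\<lambda>i. U i \<omega>) ?A))
      borel ((\<lambda>p. p Outcome) \<circ> (\<lambda>\<omega>. restrict (\<lambda>i. U i \<omega>) ?B))"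
    by (rule indep_var_compose)
      (auto intro!: measurable_compose[OF _ h] borel_measurable_vec_lambda measurable_component_singleton)
  then show ?thesis by (simp add: comp_def feature_noise_def)
qed

text \<open>Substituting the outcome equation brings the prediction error into the form
  \<open>X - Y\<close> of \<open>second_moment_indep_le\<close>, with \<open>Y\<close> the outcome
  noise.\<close>

lemma risk_eq:
  assumes "best_response_rule M g U c b f' \<alpha>"
    and f[measurable]: "f \<in> borel_measurable borel"
  shows "risk M g U f \<alpha> = (\<integral>\<^sup>+\<omega>. ennreal ((
      f (features g (feature_noise U \<omega> + \<alpha> (feature_noise U \<omega>)))
      - g Outcome (features g (feature_noise U \<omega> + \<alpha> (feature_noise U \<omega>)))
      - U Outcome \<omega>)\<^sup>2) \<partial>M)"
proof -
  have "(\<lambda>p :: (real ^ 'n) \<times> real. ennreal ((f (fst p) - snd p)\<^sup>2))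
      \<in> borel_measurable (borel \<Otimes>\<^sub>M borel)"
    by measurable
  then show ?thesis
    unfolding risk_def induced_dist_def joint_law_def borel_prod
    by (subst nn_integral_distr[OF measurable_joint[OF measurable_noise_plus_response[OF assms(1)]]])
      (simp_all add: diff_diff_eq)
qed

lemma risk_le:
  assumes U: "integrable M (U Outcome)" "(\<integral>\<omega>. U Outcome \<omega> \<partial>M) = 0"
    and Y: "best_response_rule M g U c b (g Outcome) \<alpha>\<^sub>Y"
    and f: "best_response_rule M g U c b f \<alpha>" and fm[measurable]: "f \<in> borel_measurable borel"
  shows "risk M g U (g Outcome) \<alpha>\<^sub>Y \<le> risk M g U f \<alpha>"
proof -
  have [measurable]: "\<alpha> \<in> borel_measurable borel"
    using f by (simp add: best_response_rule_def)
  \<comment> \<open>Since the rule, ties included, is a function of \<open>u\<close>, so is the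
    discrepancy.\<close>
  have "(\<lambda>u. f (features g (u + \<alpha> u)) - g Outcome (features g (u + \<alpha> u))) \<in> borel_measurable borel"
    by measurable
  from second_moment_indep_le[OF indep_var_feature_noise_outcome[OF this] U]
  show ?thesis
    \<comment> \<open>For \<open>g Outcome\<close> the discrepancy vanishes identically, so its risk
      is the second moment of \<open>U Outcome\<close>.\<close>
    by (simp add: risk_eq[OF Y] risk_eq[OF f])
qed

end

theorem proposition1:
  fixes M :: "'w measure"
    and E :: "('n::finite node \<times> 'n node) set"
    and g :: "'n node \<Rightarrow> real ^ 'n \<Rightarrow> real"
    and U :: "'n node \<Rightarrow> 'w \<Rightarrow> real"
    and c :: "real ^ 'n \<Rightarrow> real ^ 'n \<Rightarrow> real"
    and b :: real
    and \<alpha>\<^sub>Y :: "real ^ 'n \<Rightarrow> real ^ 'n"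
  assumes "additive_noise_scm M E g U"
    and "\<forall>i. ancestor E (Feature i) Outcome"
    and "integrable M (U Outcome)" and "(\<integral>\<omega>. U Outcome \<omega> \<partial>M) = 0"
    and "regular_cost c b"
    and "best_response_rule M g U c b (g Outcome) \<alpha>\<^sub>Y"
  shows "(integrable (natural_dist M g U) snd \<longrightarrow>
          integrable (induced_dist M g U \<alpha>\<^sub>Y) snd \<longrightarrow>
            (\<forall>f \<alpha>. best_response_rule M g U c b f \<alpha> \<longrightarrow>
                   integrable (induced_dist M g U \<alpha>) snd \<longrightarrow>
                   improvement M g U \<alpha> \<le> improvement M g U \<alpha>\<^sub>Y)) \<and>
         (\<forall>f \<alpha>. f \<in> borel_measurable borel \<longrightarrow> best_response_rule M g U c b f \<alpha> \<longrightarrow>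
                risk M g U (g Outcome) \<alpha>\<^sub>Y \<le> risk M g U f \<alpha>)"
proof -
  interpret additive_noise_scm M E g U by fact
  show ?thesis
    using improvement_le[OF assms(6)] risk_le[OF assms(3,4,6)] by blast
qed

end
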